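(* Suppose $f:3^N\rightarrow \mathbb{R}$ is a bisubmodular function with $f(\emptyset,\emptyset) = 0$. Then the convex hull of the epigraph of $f$, $\mathcal{Q}_f$, is described completely by the extremal poly-bimatroid inequalities $\pi^\top x \leq z$ (one for each extreme point $\pi$ of $\mathcal{P}_f$) and the trivial inequalities $\boldsymbol{-1}\leq x \leq \boldsymbol{1}$. That is, $$\mathcal{Q}_f = \{(x,z)\in\mathbb{R}^n\times\mathbb{R} \mid \pi^\top x\leq z \text{ for every extreme point } \pi \text{ of } \mathcal{P}_f,\ -1\leq x_i\leq 1 \text{ for all } i\in N\}.$$
   Context: Let $N=\{1,2,\dots,n\}$ be a finite non-empty set and let $3^N=\{(S_1,S_2)\mid S_1,S_2\subseteq N,\ S_1\cap S_2=\emptyset\}$ be the collection of all pairs of disjoint subsets of $N$. A function $f:3^N\to\mathbb{R}$ is bisubmodular if for all $(X_1,X_2),(Y_1,Y_2)\in 3^N$, $$f(X_1, X_2) + f(Y_1, Y_2) \geq f(X_1\cap Y_1, X_2 \cap Y_2) + f((X_1\cup Y_1 )\setminus (X_2 \cup Y_2),\ (X_2 \cup Y_2)\setminus (X_1\cup Y_1 )).$$ For $x\in\{-1,0,1\}^n$, write $f(x)=f(S_1^x,S_2^x)$, where $S_1^x=\{i\in N\mid x_i=1\}$ and $S_2^x=\{i\in N\mid x_i=-1\}$. The convex hull of the epigraph of $f$ is $$\mathcal{Q}_f=\mathrm{conv}\{(x,z)\in\{-1,0,1\}^n\times\mathbb{R}\mid f(x)\leq z\}.$$ The bisubmodular polyhedron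 associated with $f$ is $$\mathcal{P}_f=\Big\{\pi\in\mathbb{R}^n\ \Big|\ \sum_{i\in S_1}\pi_i-\sum_{j\in S_2}\pi_j\leq f(S_1,S_2)\ \text{ for all }(S_1,S_2)\in 3^N\Big\}.$$ A poly-bimatroid inequality is an inequality $z\geq\pi^\top x$ with $\pi\in\mathcal{P}_f$; it is called extremal if $\pi$ is an extreme point of $\mathcal{P}_f$. The trivial inequalities are $-1\leq x_i\leq 1$ for $i\in N$. *)

theory Defs
  imports "HOL-Analysis.Analysis"
begin

text \<open>
  The ground set \<open>N\<close> is the universe of a finite type \<open>'n\<close>, so that \<open>\<real>\<^sup>n\<close> is \<open>real ^ 'n\<close>.
  A function on \<open>3\<^sup>N\<close> is represented by a total function on pairs of subsets of \<open>N\<close>; all notions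
  below consult it only on disjoint pairs, so its values elsewhere are irrelevant.
\<close>

definition disjoint_pairs :: "('n set \<times> 'n set) set" where
  "disjoint_pairs = {(S1, S2). S1 \<inter> S2 = {}}"

definition bisubmodular :: "('n set \<times> 'n set \<Rightarrow> real) \<Rightarrow> bool" where
  "bisubmodular f \<longleftrightarrow>
     (\<forall>(X1, X2) \<in> disjoint_pairs. \<forall>(Y1, Y2) \<in> disjoint_pairs.
        f (X1, X2) + f (Y1, Y2) \<ge>
          f (X1 \<inter> Y1, X2 \<inter> Y2)
          + f ((X1 \<union> Y1) - (X2 \<union> Y2), (X2 \<union> Y2) - (X1 \<union> Y1)))"

definition signed_support :: "real ^ 'n \<Rightarrow> 'n set \<times> 'n set" where
  "signed_support x = ({i. x $ i = 1}, {i. x $ i = -1})"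

definition epigraph_hull :: "('n::finite set \<times> 'n set \<Rightarrow> real) \<Rightarrow> ((real ^ 'n) \<times> real) set" where
  "epigraph_hull f =
     convex hull {(x, z). (\<forall>i. x $ i \<in> {-1, 0, 1}) \<and> f (signed_support x) \<le> z}"

definition bisubmodular_polyhedron :: "('n::finite set \<times> 'n set \<Rightarrow> real) \<Rightarrow> (real ^ 'n) set" where
  "bisubmodular_polyhedron f =
     {p. \<forall>(S1, S2) \<in> disjoint_pairs. (\<Sum>i\<in>S1. p $ i) - (\<Sum>j\<in>S2. p $ j) \<le> f (S1, S2)}"

end

theory Submission
  imports Defs
begin

text \<open>
  Order the coordinates of a point \<open>x\<close> of the cube by decreasing \<open>\<bar>x\<^sub>i\<bar>\<close> and orient them by the sign
  of \<open>x\<^sub>i\<close>. The oriented initial segments form a chain of signed sets, and \<open>x\<close> is a convex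
  combination of their characteristic vectors. On a single orthant \<open>f\<close> is submodular, so the
  greedy vector \<open>\<pi>\<close> that is tight on this chain obeys all constraints from that orthant. A
  constraint from an arbitrary signed set \<open>S\<close> then follows by pairing \<open>S\<close> with the full signed set
  of the orthant, as their meet and join both lie in the orthant. Tightness on the chain
  determines \<open>\<pi>\<close>, so \<open>\<pi>\<close> is an extreme point, and \<open>\<pi> \<bullet> x\<close> is the value at \<open>x\<close> of the convex
  combination of the values of \<open>f\<close> on the chain.
\<close>

section \<open>Signed sets as vectors and the valid inequalities\<close>

definition signed_vector :: "'n::finite set \<times> 'n set \<Rightarrow> real ^ 'n" where
  "signed_vector S = (\<chi> i. (if i \<in> fst S then 1 else 0) - (if i \<in> snd S then 1 else 0))"

lemma inner_signed_vector:
  "p \<bullet> signed_vector (S1, S2) = (\<Sum>i\<in>S1. p $ i) - (\<Sum>i\<in>S2. p $ i)"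
proof -
  have "p \<bullet> signed_vector (S1, S2)
      = (\<Sum>i\<in>UNIV. (if i \<in> S1 then p $ i else 0) - (if i \<in> S2 then p $ i else 0))"
    unfolding inner_vec_def signed_vector_def by (intro sum.cong) auto
  then show ?thesis
    by (simp add: sum_subtractf sum.If_cases)
qed

lemma bisubmodular_polyhedron_iff:
  "p \<in> bisubmodular_polyhedron f \<longleftrightarrow> (\<forall>S\<in>disjoint_pairs. p \<bullet> signed_vector S \<le> f S)"
  unfolding bisubmodular_polyhedron_def by (auto simp: inner_signed_vector)

lemma signed_support_signed_vector:
  "S \<in> disjoint_pairs \<Longrightarrow> signed_support (signed_vector S) = S"
  unfolding signed_support_def signed_vector_def disjoint_pairs_def
  by (auto split: if_splits)

lemma signed_vector_signed_support:
  "\<forall>i. x $ i \<in> {-1, 0, 1} \<Longrightarrow> signed_vector (signed_support x) = x"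
  by (auto simp: signed_support_def signed_vector_def vec_eq_iff)

lemma signed_support_disjoint: "signed_support x \<in> disjoint_pairs"
  by (auto simp: signed_support_def disjoint_pairs_def)

text \<open>Where the two pairs have opposite signs, both sides vanish; elsewhere they agree
  coordinatewise. Hence a linear functional meets the bisubmodular inequality with equality.\<close>

lemma signed_vector_meet_join:
  "signed_vector (X1 \<inter> Y1, X2 \<inter> Y2)
     + signed_vector ((X1 \<union> Y1) - (X2 \<union> Y2), (X2 \<union> Y2) - (X1 \<union> Y1))
   = signed_vector (X1, X2) + signed_vector (Y1, Y2)"
  if "X1 \<inter> X2 = {}" "Y1 \<inter> Y2 = {}"
  using that by (auto simp: signed_vector_def vec_eq_iff)

lemma bisubmodularD:
  assumes "bisubmodular f" "X1 \<inter> X2 = {}" "Y1 \<inter> Y2 = {}"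
  shows "f (X1 \<inter> Y1, X2 \<inter> Y2) + f ((X1 \<union> Y1) - (X2 \<union> Y2), (X2 \<union> Y2) - (X1 \<union> Y1))
    \<le> f (X1, X2) + f (Y1, Y2)"
  using assms unfolding bisubmodular_def disjoint_pairs_def by blast

lemma signed_vector_in_epigraph_hull:
  assumes "S \<in> disjoint_pairs" "f S \<le> z"
  shows "(signed_vector S, z) \<in> epigraph_hull f"
proof -
  have "signed_vector S $ i \<in> {-1, 0, 1}" for i
    using assms(1) by (auto simp: signed_vector_def)
  then show ?thesis
    unfolding epigraph_hull_def using assms
    by (intro hull_inc) (simp add: signed_support_signed_vector)
qed

lemma epigraph_hull_subset:
  "epigraph_hull f \<subseteq> {(x, z). (\<forall>p\<in>bisubmodular_polyhedron f. p \<bullet> x \<le> z)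
    \<and> (\<forall>i. -1 \<le> x $ i \<and> x $ i \<le> 1)}" (is "_ \<subseteq> ?Q")
  unfolding epigraph_hull_def
proof (rule hull_minimal)
  show "{(x, z). (\<forall>i. x $ i \<in> {-1, 0, 1}) \<and> f (signed_support x) \<le> z} \<subseteq> ?Q"
  proof clarify
    fix x :: "real ^ 'a" and z
    assume x: "\<forall>i. x $ i \<in> {-1, 0, 1}" and z: "f (signed_support x) \<le> z"
    have "p \<bullet> x \<le> z" if "p \<in> bisubmodular_polyhedron f" for p
      using that signed_support_disjoint[of x] signed_vector_signed_support[OF x] z
      unfolding bisubmodular_polyhedron_iff by fastforce
    moreover have "-1 \<le> x $ i \<and> x $ i \<le> 1" for i
      using x[rule_format, of i] by auto
    ultimately show "(\<forall>p\<in>bisubmodular_polyhedron f. p \<bullet> x \<le> z)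
        \<and> (\<forall>i. -1 \<le> x $ i \<and> x $ i \<le> 1)"
      by blast
  qed
next
  \<comment> \<open>Convexity is read off from half-spaces: \<open>(p, -1)\<close> paired with
    \<open>(x, z)\<close> is \<open>p \<bullet> x - z\<close>.\<close>
  have eq: "?Q = (\<Inter>p\<in>bisubmodular_polyhedron f. {w. (p, -1) \<bullet> w \<le> 0})
      \<inter> (\<Inter>i. {w. (axis i 1, 0) \<bullet> w \<le> 1} \<inter> {w. (axis i 1, 0) \<bullet> w \<ge> -1})"
    by (auto simp: inner_axis')
  show "convex ?Q"
    unfolding eq by (intro convex_Int convex_INT convex_halfspace_le convex_halfspace_ge)
qed

section \<open>Submodularity on one orthant\<close>

definition orthant_pair :: "'n set \<Rightarrow> 'n set \<Rightarrow> 'n set \<times> 'n set" where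
  "orthant_pair P U = (U \<inter> P, U - P)"

lemma orthant_pair_disjoint: "orthant_pair P U \<in> disjoint_pairs"
  by (auto simp: orthant_pair_def disjoint_pairs_def)

lemma signed_vector_orthant_pair_nth:
  "signed_vector (orthant_pair P U) $ i = (if i \<in> U then if i \<in> P then 1 else -1 else 0)"
  by (auto simp: signed_vector_def orthant_pair_def)

lemma signed_vector_orthant_pair_insert:
  assumes "e \<notin> U"
  shows "signed_vector (orthant_pair P (insert e U))
    = signed_vector (orthant_pair P U) + (if e \<in> P then 1 else -1) *\<^sub>R axis e 1"
  using assms by (auto simp: vec_eq_iff signed_vector_orthant_pair_nth axis_def)

text \<open>Within an orthant no signs conflict, so the meet and join of signed sets reduce to the
  intersection and union of their supports.\<close>

lemma bisubmodular_orthant_submodular: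
  assumes "bisubmodular f"
  shows "f (orthant_pair P (U \<inter> V)) + f (orthant_pair P (U \<union> V))
    \<le> f (orthant_pair P U) + f (orthant_pair P V)"
proof -
  have "U \<inter> P \<inter> (V \<inter> P) = U \<inter> V \<inter> P" "(U - P) \<inter> (V - P) = U \<inter> V - P"
    "(U \<inter> P \<union> V \<inter> P) - ((U - P) \<union> (V - P)) = (U \<union> V) \<inter> P"
    "((U - P) \<union> (V - P)) - (U \<inter> P \<union> V \<inter> P) = (U \<union> V) - P"
    by auto
  with bisubmodularD[OF assms, of "U \<inter> P" "U - P" "V \<inter> P" "V - P"] show ?thesis
    unfolding orthant_pair_def by auto
qed

section \<open>The greedy vector of an ordered orthant\<close>

locale bisubmodular_greedy =
  fixes f :: "'n::finite set \<times> 'n set \<Rightarrow> real" and P :: "'n set" and h :: "nat \<Rightarrow> 'n"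
  assumes bisub: "bisubmodular f"
    and f_empty: "f ({}, {}) = 0"
    and bij: "bij_betw h {..<CARD('n)} UNIV"
begin

definition segment :: "nat \<Rightarrow> 'n set \<times> 'n set" where
  "segment k = orthant_pair P (h ` {..<k})"

text \<open>The sign factor undoes the orientation by \<open>P\<close>, so that passing from
  \<open>segment k\<close> to \<open>segment (Suc k)\<close> raises the inner product by exactly the
  marginal value of \<open>f\<close>.\<close>

definition greedy :: "real ^ 'n" where
  "greedy = (\<chi> i. let k = inv_into {..<CARD('n)} h i in
     (if i \<in> P then 1 else -1) * (f (segment (Suc k)) - f (segment k)))"

lemma image_full: "h ` {..<CARD('n)} = UNIV"
  using bij by (simp add: bij_betw_def)

lemma h_in_image_iff: "k < CARD('n) \<Longrightarrow> m \<le> CARD('n) \<Longrightarrow> h k \<in> h ` {..<m} \<longleftrightarrow> k < m"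
  using bij unfolding bij_betw_def by (subst inj_on_image_mem_iff) auto

lemma h_cases: obtains k where "k < CARD('n)" "i = h k"
  using image_full by (metis UNIV_I imageE lessThan_iff)

lemma greedy_nth:
  assumes "k < CARD('n)"
  shows "greedy $ h k = (if h k \<in> P then 1 else -1) * (f (segment (Suc k)) - f (segment k))"
  using assms bij by (simp add: greedy_def bij_betw_def)

lemma signed_vector_segment_Suc:
  assumes "k < CARD('n)"
  shows "signed_vector (segment (Suc k))
    = signed_vector (segment k) + (if h k \<in> P then 1 else -1) *\<^sub>R axis (h k) 1"
  using h_in_image_iff[OF assms, of k] assms
  by (simp add: segment_def lessThan_Suc signed_vector_orthant_pair_insert)

lemma greedy_segment:
  "k \<le> CARD('n) \<Longrightarrow> greedy \<bullet> signed_vector (segment k) = f (segment k)"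
proof (induction k)
  case 0
  then show ?case
    by (simp add: segment_def orthant_pair_def f_empty inner_signed_vector)
next
  case (Suc k)
  then show ?case
    by (auto simp: signed_vector_segment_Suc inner_right_distrib inner_axis greedy_nth)
qed

text \<open>Induction on the initial segment that contains \<open>U\<close>. By submodularity, the
  marginal value of the last element \<open>h k\<close> over \<open>U - {h k}\<close> is at least
  its marginal value over the whole preceding segment, which is what \<open>greedy\<close>
  gains.\<close>

lemma greedy_orthant: "greedy \<bullet> signed_vector (orthant_pair P U) \<le> f (orthant_pair P U)"
proof -
  have "greedy \<bullet> signed_vector (orthant_pair P U) \<le> f (orthant_pair P U)"
    if "k \<le> CARD('n)" "U \<subseteq> h ` {..<k}" for k
    using that
  proof (induction k arbitrary: U)
    case 0
    then show ?case
      by (simp add: orthant_pair_def f_empty inner_signed_vector)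
  next
    case (Suc k)
    let ?V = "U - {h k}" and ?A = "h ` {..<k}"
    have V: "?V \<subseteq> ?A"
      using Suc.prems(2) by (auto simp: lessThan_Suc)
    have IH: "greedy \<bullet> signed_vector (orthant_pair P ?V) \<le> f (orthant_pair P ?V)"
      using Suc.IH[OF _ V] Suc.prems(1) by simp
    show ?case
    proof (cases "h k \<in> U")
      case True
      have notin: "h k \<notin> ?A"
        using h_in_image_iff[of k k] Suc.prems(1) by simp
      have "U \<inter> ?A = ?V"
        using V notin by blast
      moreover have "U \<union> ?A = h ` {..<Suc k}"
        using V True by (auto simp: lessThan_Suc)
      ultimately have "f (orthant_pair P ?V) + f (segment (Suc k)) \<le> f (orthant_pair P U) + f (segment k)"
        using bisubmodular_orthant_submodular[OF bisub, of P U ?A] by (simp add: segment_def)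
      moreover have "greedy \<bullet> signed_vector (orthant_pair P U)
          = greedy \<bullet> signed_vector (orthant_pair P ?V) + f (segment (Suc k)) - f (segment k)"
        using signed_vector_orthant_pair_insert[of "h k" ?V P] True Suc.prems(1)
        by (auto simp: insert_absorb inner_right_distrib inner_axis greedy_nth)
      ultimately show ?thesis
        using IH by simp
    next
      case False
      then show ?thesis
        using IH by simp
    qed
  qed
  from this[of "CARD('n)"] show ?thesis
    by (simp add: image_full)
qed

lemma greedy_in_polyhedron: "greedy \<in> bisubmodular_polyhedron f"
  unfolding bisubmodular_polyhedron_iff
proof clarify
  fix S1 S2 :: "'n set"
  assume "(S1, S2) \<in> disjoint_pairs"
  then have disj: "S1 \<inter> S2 = {}"
    by (simp add: disjoint_pairs_def)
  \<comment> \<open>\<open>?D\<close> collects the coordinates whose sign in \<open>(S1, S2)\<close>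
    conflicts with the orthant. They cancel in the join with \<open>(P, - P)\<close>; all others
    survive.\<close>
  let ?D = "(S1 - P) \<union> (S2 \<inter> P)"
  have meet: "(S1 \<inter> P, S2 \<inter> - P) = orthant_pair P ((S1 \<inter> P) \<union> (S2 - P))"
    and join: "((S1 \<union> P) - (S2 \<union> - P), (S2 \<union> - P) - (S1 \<union> P)) = orthant_pair P (- ?D)"
    and full: "(P, - P) = segment (CARD('n))"
    using disj by (auto simp: orthant_pair_def segment_def image_full)
  have f_le: "f (orthant_pair P ((S1 \<inter> P) \<union> (S2 - P))) + f (orthant_pair P (- ?D))
      \<le> f (S1, S2) + f (segment (CARD('n)))"
    using bisubmodularD[OF bisub disj, of P "- P"] unfolding meet join full by simp
  have "signed_vector (orthant_pair P ((S1 \<inter> P) \<union> (S2 - P))) + signed_vector (orthant_pair P (- ?D))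
      = signed_vector (S1, S2) + signed_vector (segment (CARD('n)))"
    using signed_vector_meet_join[OF disj, of P "- P"] unfolding meet join full by simp
  then have "greedy \<bullet> signed_vector (orthant_pair P ((S1 \<inter> P) \<union> (S2 - P)))
        + greedy \<bullet> signed_vector (orthant_pair P (- ?D))
      = greedy \<bullet> signed_vector (S1, S2) + f (segment (CARD('n)))"
    by (metis inner_right_distrib greedy_segment order_refl)
  \<comment> \<open>\<open>greedy\<close> is bounded by \<open>f\<close> on meet and join and tight
    on the full segment, whose value cancels.\<close>
  with f_le greedy_orthant show "greedy \<bullet> signed_vector (S1, S2) \<le> f (S1, S2)"
    by (smt (verit))
qed

text \<open>Consecutive segment vectors differ by a signed unit vector, so differences of the inner
  products recover every coordinate.\<close>

lemma eq_if_inner_segment_eq: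
  assumes "\<And>k. k \<le> CARD('n) \<Longrightarrow> a \<bullet> signed_vector (segment k) = b \<bullet> signed_vector (segment k)"
  shows "a = b"
  unfolding vec_eq_iff
proof
  fix i
  obtain k where k: "k < CARD('n)" "i = h k"
    by (rule h_cases)
  show "a $ i = b $ i"
    using assms[of k] assms[of "Suc k"] k
    by (auto simp: signed_vector_segment_Suc inner_right_distrib inner_axis split: if_splits)
qed

lemma greedy_extreme: "greedy extreme_point_of bisubmodular_polyhedron f"
  unfolding extreme_point_of_def
proof (intro conjI ballI notI)
  show "greedy \<in> bisubmodular_polyhedron f"
    by (rule greedy_in_polyhedron)
next
  fix a b
  assume a: "a \<in> bisubmodular_polyhedron f" and b: "b \<in> bisubmodular_polyhedron f"
    and "greedy \<in> open_segment a b"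
  then obtain u where u: "0 < u" "u < 1" and g: "greedy = (1 - u) *\<^sub>R a + u *\<^sub>R b" and "a \<noteq> b"
    by (auto simp: in_segment)
  have "a \<bullet> signed_vector (segment k) = b \<bullet> signed_vector (segment k)" if "k \<le> CARD('n)" for k
  proof -
    let ?v = "signed_vector (segment k)"
    have le: "a \<bullet> ?v \<le> f (segment k)" "b \<bullet> ?v \<le> f (segment k)"
      using a b unfolding bisubmodular_polyhedron_iff segment_def
      by (auto simp: orthant_pair_disjoint)
    \<comment> \<open>The weighted slacks of \<open>a\<close> and \<open>b\<close> add up to the
      slack of \<open>greedy\<close>, which is zero; being nonnegative, both vanish.\<close>
    have "(1 - u) * (f (segment k) - a \<bullet> ?v) + u * (f (segment k) - b \<bullet> ?v) = 0"
      using greedy_segment[OF that] unfolding g by (simp add: inner_left_distrib algebra_simps)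
    moreover have "0 \<le> (1 - u) * (f (segment k) - a \<bullet> ?v)" "0 \<le> u * (f (segment k) - b \<bullet> ?v)"
      using le u by auto
    ultimately have "(1 - u) * (f (segment k) - a \<bullet> ?v) = 0" "u * (f (segment k) - b \<bullet> ?v) = 0"
      by linarith+
    then show ?thesis
      using u by simp
  qed
  with \<open>a \<noteq> b\<close> show False
    using eq_if_inner_segment_eq by blast
qed

lemma in_epigraph_hull_if_greedy_le:
  assumes le1: "\<And>i. \<bar>x $ i\<bar> \<le> 1" and P: "P = {i. 0 \<le> x $ i}"
    and sorted: "\<And>j k. j \<le> k \<Longrightarrow> k < CARD('n) \<Longrightarrow> \<bar>x $ h k\<bar> \<le> \<bar>x $ h j\<bar>"
    and z: "greedy \<bullet> x \<le> z"
  shows "(x, z) \<in> epigraph_hull f"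
proof -
  \<comment> \<open>The sorted absolute values are shifted by one index and framed by 1 and 0. Their
    successive drops \<open>w k\<close> are the weights of the segments, the empty one included, and
    telescope to total 1.\<close>
  define t :: "nat \<Rightarrow> real"
    where "t k = (case k of 0 \<Rightarrow> 1 | Suc j \<Rightarrow> if j < CARD('n) then \<bar>x $ h j\<bar> else 0)" for k
  define w where "w k = t k - t (Suc k)" for k
  define v where "v k = signed_vector (segment k)" for k
  have w_nonneg: "0 \<le> w k" for k
    by (auto simp: w_def t_def le1 split: nat.split intro!: sorted)
  have w_tail: "(\<Sum>k=m..CARD('n). w k) = t m" if "m \<le> CARD('n)" for m
    using sum_Suc_diff[of m "CARD('n)" "\<lambda>k. - t k"] that
    by (simp add: w_def t_def)
  have w_sum: "(\<Sum>k=0..CARD('n). w k) = 1"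
    by (simp add: w_tail t_def)
  have x_eq: "(\<Sum>k=0..CARD('n). w k *\<^sub>R v k) = x"
    unfolding vec_eq_iff
  proof
    fix i
    obtain j where j: "j < CARD('n)" "i = h j"
      by (rule h_cases)
    let ?s = "if h j \<in> P then 1 else - 1 :: real"
    \<comment> \<open>\<open>h j\<close> lies in segment \<open>k\<close> exactly when
      \<open>j < k\<close>, so the remaining tail telescopes to \<open>t (Suc j)\<close>.\<close>
    have "(\<Sum>k=0..CARD('n). w k *\<^sub>R v k) $ i = (\<Sum>k=0..CARD('n). if j < k then ?s * w k else 0)"
      unfolding sum_component using j
      by (intro sum.cong) (auto simp: v_def segment_def signed_vector_orthant_pair_nth h_in_image_iff)
    also have "\<dots> = (\<Sum>k=Suc j..CARD('n). ?s * w k)"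
      by (intro sum.mono_neutral_cong_right) auto
    also have "\<dots> = ?s * \<bar>x $ h j\<bar>"
      using w_tail[of "Suc j"] j by (simp add: sum_distrib_left[symmetric] t_def)
    also have "\<dots> = x $ i"
      using j P by auto
    finally show "(\<Sum>k=0..CARD('n). w k *\<^sub>R v k) $ i = x $ i" .
  qed
  \<comment> \<open>Every vertex is lifted by the same nonnegative slack, so the heights average to
    exactly \<open>z\<close>, while tightness of \<open>greedy\<close> keeps each lifted vertex in
    the epigraph.\<close>
  let ?c = "\<lambda>k. greedy \<bullet> v k + (z - greedy \<bullet> x)"
  have "(\<Sum>k=0..CARD('n). w k *\<^sub>R (v k, ?c k)) \<in> epigraph_hull f"
  proof (rule convex_sum)
    show "convex (epigraph_hull f)"
      by (simp add: epigraph_hull_def)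
    show "(v k, ?c k) \<in> epigraph_hull f" if "k \<in> {0..CARD('n)}" for k
      unfolding v_def using that z greedy_segment[of k]
      by (intro signed_vector_in_epigraph_hull) (auto simp: segment_def orthant_pair_disjoint)
  qed (use w_sum w_nonneg in auto)
  moreover have "(\<Sum>k=0..CARD('n). w k * ?c k) = z"
  proof -
    have "(\<Sum>k=0..CARD('n). w k * ?c k)
        = greedy \<bullet> (\<Sum>k=0..CARD('n). w k *\<^sub>R v k) + (\<Sum>k=0..CARD('n). w k) * (z - greedy \<bullet> x)"
      unfolding inner_sum_right sum_distrib_right sum.distrib[symmetric]
      by (simp add: algebra_simps)
    then show ?thesis
      unfolding x_eq w_sum by simp
  qed
  ultimately show ?thesis
    using x_eq by (simp add: sum_prod)
qed

end

section \<open>Sorting the coordinates and the complete description\<close>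

lemma obtain_decreasing_enumeration:
  fixes y :: "'n::finite \<Rightarrow> real"
  obtains h where "bij_betw h {..<CARD('n)} UNIV"
    and "\<And>j k. j \<le> k \<Longrightarrow> k < CARD('n) \<Longrightarrow> y (h k) \<le> y (h j)"
proof -
  obtain ys :: "'n list" where ys: "set ys = UNIV" "distinct ys"
    using finite_distinct_list[OF finite, of "UNIV :: 'n set"] by blast
  \<comment> \<open>\<open>sort_key\<close> sorts in ascending order, hence the negated key.\<close>
  define xs where "xs = sort_key (\<lambda>i. - y i) ys"
  have xs: "set xs = UNIV" "distinct xs"
    using ys by (simp_all add: xs_def)
  then have len: "length xs = CARD('n)"
    by (metis distinct_card)
  have "sorted (map (\<lambda>i. - y i) xs)"
    by (simp add: xs_def)
  then have "y (xs ! k) \<le> y (xs ! j)" if "j \<le> k" "k < CARD('n)" for j k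
    using sorted_nth_mono[of "map (\<lambda>i. - y i) xs" j k] that len by simp
  moreover have "bij_betw (nth xs) {..<CARD('n)} UNIV"
    by (rule bij_betw_nth) (use xs len in auto)
  ultimately show ?thesis
    using that by blast
qed

theorem theorem3p6:
  fixes f :: "'n::finite set \<times> 'n set \<Rightarrow> real"
  assumes "bisubmodular f"
    and "f ({}, {}) = 0"
  shows "epigraph_hull f =
    {(x, z). (\<forall>p. p extreme_point_of bisubmodular_polyhedron f \<longrightarrow> p \<bullet> x \<le> z)
             \<and> (\<forall>i. -1 \<le> x $ i \<and> x $ i \<le> 1)}"
    (is "_ = ?Q")
proof
  show "epigraph_hull f \<subseteq> ?Q"
    using epigraph_hull_subset[of f] by (fastforce simp: extreme_point_of_def)
next
  show "?Q \<subseteq> epigraph_hull f"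
  proof clarify
    fix x :: "real ^ 'n" and z
    assume ext: "\<forall>p. p extreme_point_of bisubmodular_polyhedron f \<longrightarrow> p \<bullet> x \<le> z"
      and box: "\<forall>i. -1 \<le> x $ i \<and> x $ i \<le> 1"
    obtain h where h: "bij_betw h {..<CARD('n)} UNIV"
      and dec: "\<And>j k. j \<le> k \<Longrightarrow> k < CARD('n) \<Longrightarrow> \<bar>x $ h k\<bar> \<le> \<bar>x $ h j\<bar>"
      using obtain_decreasing_enumeration[of "\<lambda>i. \<bar>x $ i\<bar>"] by blast
    \<comment> \<open>The orthant is chosen to contain \<open>x\<close>; zero coordinates are
      oriented positively by convention.\<close>
    interpret bisubmodular_greedy f "{i. 0 \<le> x $ i}" h
      by unfold_locales (use assms h in auto)
    show "(x, z) \<in> epigraph_hull f"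
    proof (rule in_epigraph_hull_if_greedy_le)
      show "\<bar>x $ i\<bar> \<le> 1" for i
        using box[rule_format, of i] by linarith
      show "greedy \<bullet> x \<le> z"
        using ext greedy_extreme by blast
    qed (use dec in auto)
  qed
qed

end
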